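(* Let $\lambda, D \in \mathbb{N}$ and $\mathcal{K} = \{0,1\}^\lambda$. Let $\Pi$ be a symmetric encryption scheme with key space $\mathcal{K}$ and message space $\mathcal{M}$, and let $\Sigma$ be a keyless key wrap scheme for key space $\mathcal{K}$ with maximum difficulty level $D$. Let $\Gamma = \Gamma[\Pi,\Sigma]$ be the difficulty-based keyless encryption scheme built from $\Pi$ and $\Sigma$. If $\Sigma$ is a key-indistinguishable difficulty-based keyless key wrap scheme and $\Pi$ is a one-time indistinguishable symmetric encryption scheme, then $\Gamma$ is a secure difficulty-based keyless encryption scheme, in the following precise sense. Let $d \le D$ and let $\mathcal{A}$ be a probabilistic algorithm (an adversary in the experiment $\mathrm{Exp}^{\mathsf{db\text{-}ind}}_{\Gamma,d}$). Then there exist algorithms $\mathcal{B}_1$ and $\mathcal{B}_2$ (using $\mathcal{A}$ as a subroutine, written $\mathcal{B}_1^{\mathcal{A}}$, $\mathcal{B}_2^{\mathcal{A}}$) such that $$\mathrm{Adv}^{\mathsf{db\text{-}ind}}_{\Gamma,d}(\mathcal{A}) \le 2 \cdot \mathrm{Adv}^{\mathsf{key\text{-}ind}}_{\Sigma,d}(\mathcal{B}_1^{\mathcal{A}}) + \mathrm{Adv}^{\mathsf{ind}}_{\Pi}(\mathcal{B}_2^{\mathcal{A}}).$$ Moreover, $\mathcal{B}_1^{\mathcal{A}}$ and $\mathcal{B}_2^{\mathcal{A}}$ have about the same runtime as $\mathcal{A}$.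
   Context: Notation: $x \leftarrow_{\$} S$ denotes uniform sampling from a finite set $S$, or running a probabilistic algorithm and assigning its output to $x$. Adversaries may run in two stages, passing a state $st$ from the first to the second. Symmetric encryption scheme $\Pi$ with key space $\mathcal{K}=\{0,1\}^\lambda$ and message space $\mathcal{M}$: a probabilistic algorithm $\Pi.\mathrm{Enc}(k,m)$ taking $k\in\mathcal{K}$, $m\in\mathcal{M}$ and outputting a ciphertext $c$; and a deterministic algorithm $\Pi.\mathrm{Dec}(k,c)$ outputting a message in $\mathcal{M}$ or an error $\bot\notin\mathcal{M}$. Correctness: decrypting an honest encryption under the same key returns the message. Keyless key wrap scheme $\Sigma$ for key space $\mathcal{K}$ with maximum difficulty $D$: a probabilistic algorithm $\Sigma.\mathrm{Wrap}(d)$ taking a difficulty level $d\le D$ and outputting a pair $(k,w)$ of a key $k\in\mathcal{K}$ and a wrapped key $w$; and a deterministic algorithm $\Sigma.\mathrm{Unwrap}(w)$ outputting a key in $\mathcal{K}$ or an error $\bot\notin\mathcal{K}$. Correctness: if $(k,w)$ is output by $\mathrm{Wrap}$, then $\mathrm{Unwrap}(w)=k$ with certainty. Difficulty-based keyless encryption (DBKE) scheme $\Delta$ for message space $\mathcal{M}$ with maximum difficulty $D$: a probabilistic algorithm $\Delta.\mathrm{Enc}(d,m)$ taking $d\le D$ and $m\in\mathcal{M}$ and outputting a ciphertext; and a deterministic algorithm $\Delta.\mathrm{Dec}(c)$ outputting a message or an error $\bot\notin\mathcal{M}$ (no key is kept between the two). Correctness: $\Pr[\Delta.\mathrm{Dec}(\Delta.\mathrm{Enc}(d,m))=m]=1$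 for all $m\in\mathcal{M}$, $d\le D$. Construction $\Gamma=\Gamma[\Pi,\Sigma]$: - $\Gamma.\mathrm{Enc}(d,m)$: $(k,w)\leftarrow_{\$}\Sigma.\mathrm{Wrap}(d)$; $c\leftarrow_{\$}\Pi.\mathrm{Enc}(k,m)$; return $(c,w)$. - $\Gamma.\mathrm{Dec}((c,w))$: $k'\leftarrow\Sigma.\mathrm{Unwrap}(w)$; $m'\leftarrow\Pi.\mathrm{Dec}(k',c)$; return $m'$. Security experiments: - $\mathrm{Exp}^{\mathsf{db\text{-}ind}}_{\Delta,d}(\mathcal{A})$: $(m_0,m_1,st)\leftarrow_{\$}\mathcal{A}(1^d)$; $b\leftarrow_{\$}\{0,1\}$; $c\leftarrow_{\$}\Delta.\mathrm{Enc}(d,m_b)$; $b'\leftarrow_{\$}\mathcal{A}(c,st)$; return the truth value of $b'=b$. - $\mathrm{Exp}^{\mathsf{ind}}_{\Pi}(\mathcal{A})$: $(m_0,m_1,st)\leftarrow_{\$}\mathcal{A}()$; $k\leftarrow_{\$}\mathcal{K}$; $b\leftarrow_{\$}\{0,1\}$; $c\leftarrow_{\$}\Pi.\mathrm{Enc}(k,m_b)$; $b'\leftarrow_{\$}\mathcal{A}(c,st)$; return the truth value of $b'=b$. - $\mathrm{Exp}^{\mathsf{key\text{-}ind}}_{\Sigma,d}(\mathcal{A})$: $(k_0,w)\leftarrow_{\$}\Sigma.\mathrm{Wrap}(d)$; $k_1\leftarrow_{\$}\mathcal{K}$; $b\leftarrow_{\$}\{0,1\}$; $b'\leftarrow_{\$}\mathcal{A}(w,k_b,k_{1-b})$;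 return the truth value of $b'=b$. For each experiment, the advantage is $\mathrm{Adv}(\mathcal{A})=\left|2\cdot\Pr[\mathrm{Exp}(\mathcal{A})\Rightarrow\mathtt{true}]-1\right|$ with the matching superscript and subscripts. "About the same runtime as $\mathcal{A}$" means the runtime of $\mathcal{A}$ plus a minimal cost of either one encryption or one wrapping. *)

theory Defs
  imports "HOL-Probability.Probability"
begin

text \<open>
  An algorithm is represented by the joint distribution of its output and of the time the run took.
  Experiments only see the output; runtime statements look at the second component.
\<close>

type_synonym 'a timed = "('a \<times> nat) pmf"

definition outcome :: "'a timed \<Rightarrow> 'a pmf" where
  "outcome p = map_pmf fst p"

definition coin :: "bool pmf" where
  "coin = pmf_of_set UNIV"

type_synonym key = "bool list"

definition key_space :: "nat \<Rightarrow> key set" where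
  "key_space n = {k. length k = n}"


record ('m, 'c) sym_enc =
  enc :: "key \<Rightarrow> 'm \<Rightarrow> 'c timed"
  dec :: "key \<Rightarrow> 'c \<Rightarrow> 'm option"

definition is_sym_enc :: "nat \<Rightarrow> 'm set \<Rightarrow> ('m, 'c) sym_enc \<Rightarrow> bool" where
  "is_sym_enc n M E \<longleftrightarrow>
     (\<forall>k\<in>key_space n. \<forall>c m. dec E k c = Some m \<longrightarrow> m \<in> M) \<and>
     (\<forall>k\<in>key_space n. \<forall>m\<in>M. \<forall>c\<in>set_pmf (outcome (enc E k m)). dec E k c = Some m)"

record 'w key_wrap =
  wrap :: "nat \<Rightarrow> (key \<times> 'w) timed"
  unwrap :: "'w \<Rightarrow> key option"

definition is_key_wrap :: "nat \<Rightarrow> nat \<Rightarrow> 'w key_wrap \<Rightarrow> bool" where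
  "is_key_wrap n D W \<longleftrightarrow>
     (\<forall>w k. unwrap W w = Some k \<longrightarrow> k \<in> key_space n) \<and>
     (\<forall>d\<le>D. \<forall>(k, w)\<in>set_pmf (outcome (wrap W d)). k \<in> key_space n \<and> unwrap W w = Some k)"

record ('m, 'c) dbke =
  dbenc :: "nat \<Rightarrow> 'm \<Rightarrow> 'c timed"
  dbdec :: "'c \<Rightarrow> 'm option"

definition is_dbke :: "nat \<Rightarrow> 'm set \<Rightarrow> ('m, 'c) dbke \<Rightarrow> bool" where
  "is_dbke D M S \<longleftrightarrow>
     (\<forall>c m. dbdec S c = Some m \<longrightarrow> m \<in> M) \<and>
     (\<forall>d\<le>D. \<forall>m\<in>M. pmf (map_pmf (dbdec S) (outcome (dbenc S d m))) (Some m) = 1)"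

text \<open>Decryption propagates a failure of unwrapping.\<close>

definition wrap_encrypt :: "('m, 'c) sym_enc \<Rightarrow> 'w key_wrap \<Rightarrow> ('m, 'c \<times> 'w) dbke" where
  "wrap_encrypt E W =
     \<lparr>dbenc = (\<lambda>d m. do {
        ((k, w), s) \<leftarrow> wrap W d;
        (c, t) \<leftarrow> enc E k m;
        return_pmf ((c, w), s + t)
      }),
      dbdec = (\<lambda>(c, w). case unwrap W w of None \<Rightarrow> None | Some k \<Rightarrow> dec E k c)\<rparr>"

lemma is_dbke_wrap_encrypt:
  assumes "is_sym_enc n M E" "is_key_wrap n D W"
  shows "is_dbke D M (wrap_encrypt E W)"
proof -
  have "m \<in> M" if "dbdec (wrap_encrypt E W) c = Some m" for c m
  proof -
    obtain c' w where "c = (c', w)" by fastforce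
    with that obtain k where "unwrap W w = Some k" "dec E k c' = Some m"
      by (auto simp: wrap_encrypt_def split: option.splits)
    with assms show ?thesis
      unfolding is_sym_enc_def is_key_wrap_def by metis
  qed
  moreover have "pmf (map_pmf (dbdec (wrap_encrypt E W)) (outcome (dbenc (wrap_encrypt E W) d m))) (Some m) = 1"
    if "d \<le> D" "m \<in> M" for d m
  proof -
    have "dbdec (wrap_encrypt E W) x = Some m"
      if "x \<in> set_pmf (outcome (dbenc (wrap_encrypt E W) d m))" for x
    proof -
      from that have "x \<in> set_pmf (outcome (wrap W d) \<bind>
          (\<lambda>p. map_pmf (\<lambda>c. (c, snd p)) (outcome (enc E (fst p) m))))"
        by (simp add: wrap_encrypt_def outcome_def case_prod_unfold map_bind_pmf bind_map_pmf map_pmf_comp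
            flip: map_pmf_def)
      then obtain p c where p: "p \<in> set_pmf (outcome (wrap W d))"
        and c: "c \<in> set_pmf (outcome (enc E (fst p) m))" and x: "x = (c, snd p)"
        unfolding set_bind_pmf set_map_pmf by blast
      have "fst p \<in> key_space n" "unwrap W (snd p) = Some (fst p)"
        using assms(2) p \<open>d \<le> D\<close> unfolding is_key_wrap_def case_prod_unfold by blast+
      moreover from this(1) have "dec E (fst p) c = Some m"
        using assms(1) c \<open>m \<in> M\<close> unfolding is_sym_enc_def by blast
      ultimately show ?thesis
        by (simp add: x wrap_encrypt_def)
    qed
    then have "map_pmf (dbdec (wrap_encrypt E W)) (outcome (dbenc (wrap_encrypt E W) d m)) =
        map_pmf (\<lambda>_. Some m) (outcome (dbenc (wrap_encrypt E W) d m))"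
      by (intro map_pmf_cong refl)
    then show ?thesis by simp
  qed
  ultimately show ?thesis
    by (simp add: is_dbke_def)
qed


text \<open>
  Two-stage adversaries. The type \<open>'i\<close> is the input of the first stage: the difficulty for
  attacks on a keyless scheme (unary encoding is immaterial here), \<open>unit\<close> for attacks on a
  symmetric scheme.
\<close>

record ('i, 'm, 's, 'c) adversary =
  stage1 :: "'i \<Rightarrow> ('m \<times> 'm \<times> 's) timed"
  stage2 :: "'c \<Rightarrow> 's \<Rightarrow> bool timed"

definition valid_adversary :: "'m set \<Rightarrow> 'i \<Rightarrow> ('i, 'm, 's, 'c) adversary \<Rightarrow> bool" where
  "valid_adversary M i A \<longleftrightarrow>
     (\<forall>(m0, m1, st)\<in>set_pmf (outcome (stage1 A i)). m0 \<in> M \<and> m1 \<in> M)"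

type_synonym 'w key_adversary = "'w \<times> key \<times> key \<Rightarrow> bool timed"

definition exp_db_ind ::
    "('m, 'c) dbke \<Rightarrow> nat \<Rightarrow> (nat, 'm, 's, 'c) adversary \<Rightarrow> bool pmf" where
  "exp_db_ind S d A = do {
     (m0, m1, st) \<leftarrow> outcome (stage1 A d);
     b \<leftarrow> coin;
     c \<leftarrow> outcome (dbenc S d (if b then m1 else m0));
     b' \<leftarrow> outcome (stage2 A c st);
     return_pmf (b' = b)
   }"

definition exp_ind ::
    "nat \<Rightarrow> ('m, 'c) sym_enc \<Rightarrow> (unit, 'm, 's, 'c) adversary \<Rightarrow> bool pmf" where
  "exp_ind n E A = do {
     (m0, m1, st) \<leftarrow> outcome (stage1 A ());
     k \<leftarrow> pmf_of_set (key_space n);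
     b \<leftarrow> coin;
     c \<leftarrow> outcome (enc E k (if b then m1 else m0));
     b' \<leftarrow> outcome (stage2 A c st);
     return_pmf (b' = b)
   }"

definition exp_key_ind :: "nat \<Rightarrow> 'w key_wrap \<Rightarrow> nat \<Rightarrow> 'w key_adversary \<Rightarrow> bool pmf" where
  "exp_key_ind n W d A = do {
     (k0, w) \<leftarrow> outcome (wrap W d);
     k1 \<leftarrow> pmf_of_set (key_space n);
     b \<leftarrow> coin;
     b' \<leftarrow> outcome (A (w, if b then k1 else k0, if b then k0 else k1));
     return_pmf (b' = b)
   }"

definition advantage :: "bool pmf \<Rightarrow> real" where
  "advantage p = \<bar>2 * pmf p True - 1\<bar>"


text \<open>
  If reductions were arbitrary elements of the adversary types, they could claim any runtime.
  Reductions are therefore programs of a loop-free register language whose only nontrivial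
  operations are calls of the two stages of a given adversary, of encryption, and of wrapping.
  A call is charged the time of the callee's run; in addition every instruction costs \<open>\<tau>\<close>.
  Constants other than bits do not exist and data other than bits cannot be inspected, so the
  adversary is used as a black box.
\<close>

record ('m, 'c, 'w, 's) store =
  bits :: "nat \<Rightarrow> bool"
  keys :: "nat \<Rightarrow> key"
  msgs :: "nat \<Rightarrow> 'm"
  ctxts :: "nat \<Rightarrow> 'c"
  wkeys :: "nat \<Rightarrow> 'w"
  states :: "nat \<Rightarrow> 's"

datatype prog =
    Flip nat
  | SetBit nat bool
  | Xor nat nat nat
  | Seq prog prog
  | Cond nat prog prog
  | CallStage1 nat nat nat
  | CallStage2 nat nat nat nat
  | CallEnc nat nat nat
  | CallWrap nat nat

text \<open>Target registers come first.\<close>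

primrec exec ::
    "nat \<Rightarrow> nat \<Rightarrow> (nat, 'm, 's, 'c \<times> 'w) adversary \<Rightarrow> ('m, 'c) sym_enc \<Rightarrow> 'w key_wrap \<Rightarrow>
     prog \<Rightarrow> ('m, 'c, 'w, 's) store \<Rightarrow> ('m, 'c, 'w, 's) store timed" where
  "exec \<tau> d A E W (Flip r) \<sigma> = do {
     b \<leftarrow> coin;
     return_pmf (\<sigma>\<lparr>bits := (bits \<sigma>)(r := b)\<rparr>, \<tau>)
   }"
| "exec \<tau> d A E W (SetBit r b) \<sigma> = return_pmf (\<sigma>\<lparr>bits := (bits \<sigma>)(r := b)\<rparr>, \<tau>)"
| "exec \<tau> d A E W (Xor r i j) \<sigma> =
     return_pmf (\<sigma>\<lparr>bits := (bits \<sigma>)(r := (bits \<sigma> i \<noteq> bits \<sigma> j))\<rparr>, \<tau>)"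
| "exec \<tau> d A E W (Seq P Q) \<sigma> = do {
     (\<sigma>1, s) \<leftarrow> exec \<tau> d A E W P \<sigma>;
     (\<sigma>2, t) \<leftarrow> exec \<tau> d A E W Q \<sigma>1;
     return_pmf (\<sigma>2, s + t)
   }"
| "exec \<tau> d A E W (Cond i P Q) \<sigma> = do {
     (\<sigma>1, t) \<leftarrow> (if bits \<sigma> i then exec \<tau> d A E W P \<sigma> else exec \<tau> d A E W Q \<sigma>);
     return_pmf (\<sigma>1, t + \<tau>)
   }"
| "exec \<tau> d A E W (CallStage1 r0 r1 r) \<sigma> = do {
     ((m0, m1, st), t) \<leftarrow> stage1 A d;
     return_pmf (\<sigma>\<lparr>msgs := (msgs \<sigma>)(r0 := m0, r1 := m1), states := (states \<sigma>)(r := st)\<rparr>, t + \<tau>)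
   }"
| "exec \<tau> d A E W (CallStage2 r i j l) \<sigma> = do {
     (b, t) \<leftarrow> stage2 A (ctxts \<sigma> i, wkeys \<sigma> j) (states \<sigma> l);
     return_pmf (\<sigma>\<lparr>bits := (bits \<sigma>)(r := b)\<rparr>, t + \<tau>)
   }"
| "exec \<tau> d A E W (CallEnc r i j) \<sigma> = do {
     (c, t) \<leftarrow> enc E (keys \<sigma> i) (msgs \<sigma> j);
     return_pmf (\<sigma>\<lparr>ctxts := (ctxts \<sigma>)(r := c)\<rparr>, t + \<tau>)
   }"
| "exec \<tau> d A E W (CallWrap r0 r1) \<sigma> = do {
     ((k, w), t) \<leftarrow> wrap W d;
     return_pmf (\<sigma>\<lparr>keys := (keys \<sigma>)(r0 := k), wkeys := (wkeys \<sigma>)(r1 := w)\<rparr>, t + \<tau>)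
   }"

text \<open>Fresh memory has unspecified content. Bit registers start with \<open>False\<close>.\<close>

definition fresh :: "('m, 'c, 'w, 's) store" where
  "fresh = \<lparr>bits = (\<lambda>_. False), keys = (\<lambda>_. undefined), msgs = (\<lambda>_. undefined),
     ctxts = (\<lambda>_. undefined), wkeys = (\<lambda>_. undefined), states = (\<lambda>_. undefined)\<rparr>"

definition key_reduction ::
    "nat \<Rightarrow> nat \<Rightarrow> (nat, 'm, 's, 'c \<times> 'w) adversary \<Rightarrow> ('m, 'c) sym_enc \<Rightarrow> 'w key_wrap \<Rightarrow>
     prog \<Rightarrow> 'w key_adversary" where
  "key_reduction \<tau> d A E W P = (\<lambda>(w, k, k'). do {
     let \<sigma>0 = fresh;
     (\<sigma>, t) \<leftarrow> exec \<tau> d A E W P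
        (\<sigma>0\<lparr>wkeys := (wkeys \<sigma>0)(0 := w), keys := (keys \<sigma>0)(0 := k, 1 := k')\<rparr>);
     return_pmf (bits \<sigma> 0, t)
   })"

text \<open>The state passed between the stages of a reduction is its whole memory.\<close>

definition sym_reduction ::
    "nat \<Rightarrow> nat \<Rightarrow> (nat, 'm, 's, 'c \<times> 'w) adversary \<Rightarrow> ('m, 'c) sym_enc \<Rightarrow> 'w key_wrap \<Rightarrow>
     prog \<Rightarrow> prog \<Rightarrow> (unit, 'm, ('m, 'c, 'w, 's) store, 'c) adversary" where
  "sym_reduction \<tau> d A E W P Q =
     \<lparr>stage1 = (\<lambda>_. do {
        (\<sigma>, t) \<leftarrow> exec \<tau> d A E W P fresh;
        return_pmf ((msgs \<sigma> 0, msgs \<sigma> 1, \<sigma>), t)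
      }),
      stage2 = (\<lambda>c \<sigma>. do {
        (\<sigma>', t) \<leftarrow> exec \<tau> d A E W Q (\<sigma>\<lparr>ctxts := (ctxts \<sigma>)(0 := c)\<rparr>);
        return_pmf (bits \<sigma>' 0, t)
      })\<rparr>"


text \<open>
  Runtimes are sets of possible values. Adversaries are timed on all inputs of the right form
  and not only on those that occur in their experiment: a reduction may run an attacker on
  \<open>(c, w)\<close> where \<open>c\<close> is not encrypted under the key wrapped in \<open>w\<close>.
\<close>

definition ciphertexts :: "nat \<Rightarrow> 'm set \<Rightarrow> ('m, 'c) sym_enc \<Rightarrow> 'c set" where
  "ciphertexts n M E = (\<Union>k\<in>key_space n. \<Union>m\<in>M. set_pmf (outcome (enc E k m)))"

definition wrapped_keys :: "'w key_wrap \<Rightarrow> nat \<Rightarrow> 'w set" where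
  "wrapped_keys W d = snd ` set_pmf (outcome (wrap W d))"

definition enc_runtimes :: "nat \<Rightarrow> 'm set \<Rightarrow> ('m, 'c) sym_enc \<Rightarrow> nat set" where
  "enc_runtimes n M E = (\<Union>k\<in>key_space n. \<Union>m\<in>M. snd ` set_pmf (enc E k m))"

definition wrap_runtimes :: "'w key_wrap \<Rightarrow> nat \<Rightarrow> nat set" where
  "wrap_runtimes W d = snd ` set_pmf (wrap W d)"

definition adversary_runtimes :: "'c set \<Rightarrow> 'i \<Rightarrow> ('i, 'm, 's, 'c) adversary \<Rightarrow> nat set" where
  "adversary_runtimes C i A =
     {s + t | s t m0 m1 st c b. ((m0, m1, st), s) \<in> set_pmf (stage1 A i) \<and> c \<in> C \<and>
        (b, t) \<in> set_pmf (stage2 A c st)}"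

definition key_adversary_runtimes :: "nat \<Rightarrow> 'w set \<Rightarrow> 'w key_adversary \<Rightarrow> nat set" where
  "key_adversary_runtimes n V B =
     (\<Union>w\<in>V. \<Union>k\<in>key_space n. \<Union>k'\<in>key_space n. snd ` set_pmf (B (w, k, k')))"

text \<open>
  Every run takes at most as long as some run of the original adversary, plus one run of the extra
  operation, plus six bookkeeping instructions; \<open>\<tau> = 0\<close> means that bookkeeping is not counted.
  In particular the same bound holds for worst-case runtimes.
\<close>

definition about_same_runtime :: "nat \<Rightarrow> nat set \<Rightarrow> nat set \<Rightarrow> nat set \<Rightarrow> bool" where
  "about_same_runtime \<tau> T T_adv T_extra \<longleftrightarrow>
     (\<forall>t\<in>T. \<exists>a\<in>T_adv. \<exists>x\<in>T_extra. t \<le> a + x + 6 * \<tau>)"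

end

theory Submission
  imports Defs
begin

text \<open>
  Let \<open>p\<close> be the probability that the adversary wins its own experiment, and \<open>q\<close> the
  probability that it wins when the message is encrypted under a key that is independent of the
  wrapped key it sees. Simulating the experiment with the first of the two given keys, and betting
  that this is the wrapped key if and only if the adversary wins, breaks key indistinguishability
  with signed advantage \<open>p - q\<close>. An adversary against the encryption scheme that wraps a fresh
  key by itself wins with probability \<open>q\<close>. The claim is the triangle inequality
  \<open>\<bar>2 * p - 1\<bar> \<le> 2 * \<bar>p - q\<bar> + \<bar>2 * q - 1\<bar>\<close>.
\<close>

lemma pmf_bind_coin:
  "pmf (bind_pmf coin f) x = (pmf (f True) x + pmf (f False) x) / 2"
  by (simp add: pmf_bind coin_def integral_pmf_of_set UNIV_bool)

lemma pmf_map_Not: "pmf (map_pmf Not p) b = pmf p (\<not> b)"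
  using pmf_map_inj'[of Not p "\<not> b"] by (simp add: inj_def)

lemma pmf_False_bool: "pmf p False = 1 - pmf p True"
proof -
  have "(\<Sum>b\<in>UNIV. pmf p b) = 1"
    by (intro sum_pmf_eq_1) auto
  then show ?thesis by (simp add: UNIV_bool)
qed


text \<open>The encryption key and the wrapped key are separate arguments, so that the real
  experiment and the one with an independent key are both mixtures of this game.\<close>

definition game ::
    "nat \<Rightarrow> (nat, 'm, 's, 'c \<times> 'w) adversary \<Rightarrow> ('m, 'c) sym_enc \<Rightarrow> key \<Rightarrow> 'w \<Rightarrow> bool pmf" where
  "game d A E k w = do {
     (m0, m1, st) \<leftarrow> outcome (stage1 A d);
     b \<leftarrow> coin;
     c \<leftarrow> outcome (enc E k (if b then m1 else m0));
     b' \<leftarrow> outcome (stage2 A (c, w) st);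
     return_pmf (b' = b)
   }"

definition independent_key_game ::
    "nat \<Rightarrow> nat \<Rightarrow> (nat, 'm, 's, 'c \<times> 'w) adversary \<Rightarrow> ('m, 'c) sym_enc \<Rightarrow> 'w key_wrap \<Rightarrow>
     bool pmf" where
  "independent_key_game n d A E W = do {
     k \<leftarrow> pmf_of_set (key_space n);
     (_, w) \<leftarrow> outcome (wrap W d);
     game d A E k w
   }"

text \<open>The final \<open>Xor\<close> yields \<open>False\<close> exactly when the adversary
  wins, because \<open>False\<close> is the hidden bit for which the first key is the wrapped
  one.\<close>

definition key_prog :: prog where
  "key_prog = Seq (CallStage1 0 1 0) (Seq (Flip 1)
     (Seq (Cond 1 (CallEnc 0 0 1) (CallEnc 0 0 0)) (Seq (CallStage2 0 0 0 0) (Xor 0 0 1))))"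

text \<open>The wrapped key survives in the memory handed to \<open>sym_prog2\<close>.\<close>

definition sym_prog1 :: prog where
  "sym_prog1 = Seq (CallStage1 0 1 0) (CallWrap 0 0)"

definition sym_prog2 :: prog where
  "sym_prog2 = CallStage2 0 0 0 0"

lemma exp_db_ind_wrap_encrypt:
  "exp_db_ind (wrap_encrypt E W) d A =
     bind_pmf (outcome (wrap W d)) (\<lambda>(k, w). game d A E k w)"
proof -
  have "exp_db_ind (wrap_encrypt E W) d A = do {
     x \<leftarrow> outcome (stage1 A d);
     b \<leftarrow> coin;
     p \<leftarrow> outcome (wrap W d);
     c \<leftarrow> outcome (enc E (fst p) (if b then fst (snd x) else fst x));
     b' \<leftarrow> outcome (stage2 A (c, snd p) (snd (snd x)));
     return_pmf (b' = b)
   }"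
    by (simp add: exp_db_ind_def wrap_encrypt_def outcome_def case_prod_unfold map_bind_pmf
        bind_map_pmf bind_assoc_pmf bind_return_pmf map_pmf_comp flip: map_pmf_def)
  also have "\<dots> = bind_pmf (outcome (wrap W d)) (\<lambda>(k, w). game d A E k w)"
    unfolding game_def case_prod_unfold
    \<comment> \<open>Wrapping depends neither on the coin nor on the first stage, so it moves to
      the front past both.\<close>
    by (subst (2) bind_commute_pmf, subst bind_commute_pmf, rule refl)
  finally show ?thesis .
qed

lemma outcome_key_reduction:
  "outcome (key_reduction \<tau> d A E W key_prog (w, k, k')) = map_pmf Not (game d A E k w)"
  \<comment> \<open>\<open>Cond\<close> chooses between two encryption calls, while
    \<open>game\<close> makes one call on a conditional message; they agree for each value of the
    coin.\<close>
  by (simp add: key_reduction_def key_prog_def game_def outcome_def case_prod_unfold Let_def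
      map_bind_pmf bind_map_pmf bind_assoc_pmf bind_return_pmf map_pmf_def
      if_distrib[where f = "\<lambda>p. bind_pmf p g" for g] cong: if_cong)
     (intro bind_pmf_cong refl; auto intro!: bind_pmf_cong)

text \<open>The experiment draws the encryption key itself, independently of the key wrapped by
  \<open>sym_prog1\<close>.\<close>

lemma exp_ind_sym_reduction:
  "exp_ind n E (sym_reduction \<tau> d A E W sym_prog1 sym_prog2) = independent_key_game n d A E W"
proof -
  have "exp_ind n E (sym_reduction \<tau> d A E W sym_prog1 sym_prog2) = do {
     x \<leftarrow> outcome (stage1 A d);
     p \<leftarrow> outcome (wrap W d);
     k \<leftarrow> pmf_of_set (key_space n);
     b \<leftarrow> coin;
     c \<leftarrow> outcome (enc E k (if b then fst (snd x) else fst x));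
     b' \<leftarrow> outcome (stage2 A (c, snd p) (snd (snd x)));
     return_pmf (b' = b)
   }"
    by (simp add: exp_ind_def sym_reduction_def sym_prog1_def sym_prog2_def outcome_def
        case_prod_unfold map_bind_pmf bind_map_pmf bind_assoc_pmf bind_return_pmf map_pmf_def
        cong: if_cong)
  also have "\<dots> = independent_key_game n d A E W"
    unfolding independent_key_game_def game_def case_prod_unfold
    \<comment> \<open>The uniform key moves past wrapping and the first stage; below it, these two
      are swapped.\<close>
    by (subst (2) bind_commute_pmf, subst bind_commute_pmf,
        intro bind_pmf_cong refl, rule bind_commute_pmf)
  finally show ?thesis .
qed

text \<open>On \<open>False\<close> the reduction encrypts under the wrapped key and is right when
  the adversary wins; on \<open>True\<close> it encrypts under an independent uniform key and is
  right when the adversary loses.\<close>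

lemma exp_key_ind_key_reduction:
  "exp_key_ind n W d (key_reduction \<tau> d A E W key_prog) = do {
     b \<leftarrow> coin;
     if b then map_pmf Not (independent_key_game n d A E W)
     else exp_db_ind (wrap_encrypt E W) d A
   }"
proof -
  let ?g = "\<lambda>b p k1. map_pmf (\<lambda>v. (\<not> v) = b) (game d A E (if b then k1 else fst p) (snd p))"
  have "exp_key_ind n W d (key_reduction \<tau> d A E W key_prog) =
    bind_pmf (outcome (wrap W d)) (\<lambda>p. bind_pmf (pmf_of_set (key_space n))
      (\<lambda>k1. bind_pmf coin (\<lambda>b. ?g b p k1)))"
    unfolding exp_key_ind_def outcome_key_reduction case_prod_unfold map_pmf_def[symmetric]
    by (simp add: map_pmf_comp)
  also have "\<dots> = bind_pmf coin (\<lambda>b. bind_pmf (outcome (wrap W d))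
      (\<lambda>p. bind_pmf (pmf_of_set (key_space n)) (?g b p)))"
    by (subst (2) bind_commute_pmf, subst bind_commute_pmf, rule refl)
  also have "\<dots> = bind_pmf coin (\<lambda>b. if b then map_pmf Not (independent_key_game n d A E W)
     else exp_db_ind (wrap_encrypt E W) d A)"
  proof (intro bind_pmf_cong refl)
    fix b
    show "bind_pmf (outcome (wrap W d)) (\<lambda>p. bind_pmf (pmf_of_set (key_space n)) (?g b p)) =
      (if b then map_pmf Not (independent_key_game n d A E W)
       else exp_db_ind (wrap_encrypt E W) d A)"
      \<comment> \<open>The swap concerns the case \<open>True\<close>, where the uniform key must
        be drawn before wrapping; for \<open>False\<close> its draw is a constant bind.\<close>
      by (cases b, subst bind_commute_pmf)
        (simp_all add: independent_key_game_def exp_db_ind_wrap_encrypt case_prod_unfold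
          map_bind_pmf)
  qed
  finally show ?thesis .
qed

text \<open>The key reduction succeeds with probability \<open>(p + (1 - q)) / 2\<close>, so its
  advantage is \<open>\<bar>p - q\<bar>\<close>; the factor 2 comes from
  \<open>(2 * p - 1) - (2 * q - 1)\<close>.\<close>

lemma advantage_wrap_encrypt_le:
  "advantage (exp_db_ind (wrap_encrypt E W) d A)
     \<le> 2 * advantage (exp_key_ind n W d (key_reduction \<tau> d A E W key_prog)) +
       advantage (exp_ind n E (sym_reduction \<tau> d A E W sym_prog1 sym_prog2))"
  unfolding exp_key_ind_key_reduction exp_ind_sym_reduction advantage_def
  by (simp add: pmf_bind_coin pmf_map_Not pmf_False_bool)
     (auto simp: abs_real_def field_simps)

lemma valid_adversary_sym_reduction:
  assumes "valid_adversary M d A"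
  shows "valid_adversary M () (sym_reduction \<tau> d A E W sym_prog1 sym_prog2)"
  using assms
  by (fastforce simp: valid_adversary_def sym_reduction_def sym_prog1_def outcome_def)

lemma key_reduction_runtime:
  assumes "valid_adversary M d A"
  shows "about_same_runtime \<tau>
    (key_adversary_runtimes n (wrapped_keys W d) (key_reduction \<tau> d A E W key_prog))
    (adversary_runtimes (ciphertexts n M E \<times> wrapped_keys W d) d A) (enc_runtimes n M E)"
  unfolding about_same_runtime_def
proof
  fix t
  assume "t \<in> key_adversary_runtimes n (wrapped_keys W d) (key_reduction \<tau> d A E W key_prog)"
  then obtain w k m0 m1 st s m c u b v where
    w: "w \<in> wrapped_keys W d" and k: "k \<in> key_space n"
    and s: "((m0, m1, st), s) \<in> set_pmf (stage1 A d)"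
    and u: "(c, u) \<in> set_pmf (enc E k m)" and mm: "m \<in> {m0, m1}"
    and v: "(b, v) \<in> set_pmf (stage2 A (c, w) st)"
    \<comment> \<open>Five instructions are executed in sequence, and \<open>Cond\<close> is charged
      in addition to the encryption call in its branch.\<close>
    and t: "t = s + u + v + 6 * \<tau>"
    by (fastforce simp: key_adversary_runtimes_def key_reduction_def key_prog_def Let_def
        split: if_splits)
  \<comment> \<open>Encryption times and ciphertexts are collected over \<open>M\<close> only, so
    validity of the adversary enters here.\<close>
  have m: "m \<in> M"
    using assms s mm by (fastforce simp: valid_adversary_def outcome_def)
  have "c \<in> ciphertexts n M E"
    using k m u by (force simp: ciphertexts_def outcome_def)
  then have "s + v \<in> adversary_runtimes (ciphertexts n M E \<times> wrapped_keys W d) d A"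
    using s v w unfolding adversary_runtimes_def by blast
  moreover have "u \<in> enc_runtimes n M E"
    using k m u by (force simp: enc_runtimes_def)
  ultimately show "\<exists>a\<in>adversary_runtimes (ciphertexts n M E \<times> wrapped_keys W d) d A.
      \<exists>x\<in>enc_runtimes n M E. t \<le> a + x + 6 * \<tau>"
    using t by (intro bexI[of _ "s + v"] bexI[of _ u]) simp_all
qed

lemma sym_reduction_runtime:
  "about_same_runtime \<tau>
    (adversary_runtimes (ciphertexts n M E) () (sym_reduction \<tau> d A E W sym_prog1 sym_prog2))
    (adversary_runtimes (ciphertexts n M E \<times> wrapped_keys W d) d A) (wrap_runtimes W d)"
  unfolding about_same_runtime_def
proof
  fix t
  assume "t \<in> adversary_runtimes (ciphertexts n M E) ()
    (sym_reduction \<tau> d A E W sym_prog1 sym_prog2)"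
  then obtain m0 m1 st s k w u c b v where
    s: "((m0, m1, st), s) \<in> set_pmf (stage1 A d)"
    and u: "((k, w), u) \<in> set_pmf (wrap W d)"
    and c: "c \<in> ciphertexts n M E"
    and v: "(b, v) \<in> set_pmf (stage2 A (c, w) st)"
    \<comment> \<open>One charge for each of the two stage calls and one for wrapping.\<close>
    and t: "t = s + u + v + 3 * \<tau>"
    by (fastforce simp: adversary_runtimes_def sym_reduction_def sym_prog1_def sym_prog2_def)
  have "w \<in> wrapped_keys W d"
    using u by (force simp: wrapped_keys_def outcome_def)
  with c have "s + v \<in> adversary_runtimes (ciphertexts n M E \<times> wrapped_keys W d) d A"
    using s v unfolding adversary_runtimes_def by blast
  moreover have "u \<in> wrap_runtimes W d"
    using u by (force simp: wrap_runtimes_def)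
  ultimately show "\<exists>a\<in>adversary_runtimes (ciphertexts n M E \<times> wrapped_keys W d) d A.
      \<exists>x\<in>wrap_runtimes W d. t \<le> a + x + 6 * \<tau>"
    using t by (intro bexI[of _ "s + v"] bexI[of _ u]) simp_all
qed

theorem theorem1:
  fixes n D d \<tau> :: nat
    and M :: "'m set"
    and E :: "('m, 'c) sym_enc"
    and W :: "'w key_wrap"
    and A :: "(nat, 'm, 's, 'c \<times> 'w) adversary"
  assumes "is_sym_enc n M E"
    and "is_key_wrap n D W"
    and "d \<le> D"
    and "valid_adversary M d A"
  shows "\<exists>P\<^sub>1 P\<^sub>2 Q\<^sub>2.
    let B\<^sub>1 = key_reduction \<tau> d A E W P\<^sub>1;
        B\<^sub>2 = sym_reduction \<tau> d A E W P\<^sub>2 Q\<^sub>2;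
        T = adversary_runtimes (ciphertexts n M E \<times> wrapped_keys W d) d A
    in valid_adversary M () B\<^sub>2 \<and>
       advantage (exp_db_ind (wrap_encrypt E W) d A)
         \<le> 2 * advantage (exp_key_ind n W d B\<^sub>1) + advantage (exp_ind n E B\<^sub>2) \<and>
       about_same_runtime \<tau>
         (key_adversary_runtimes n (wrapped_keys W d) B\<^sub>1) T (enc_runtimes n M E) \<and>
       about_same_runtime \<tau>
         (adversary_runtimes (ciphertexts n M E) () B\<^sub>2) T (wrap_runtimes W d)"
  \<comment> \<open>The witnesses are closed programs, the same for all schemes, adversaries and
    difficulties.\<close>
  unfolding Let_def
  by (intro exI[of _ key_prog] exI[of _ sym_prog1] exI[of _ sym_prog2] conjI
      advantage_wrap_encrypt_le valid_adversary_sym_reduction key_reduction_runtime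
      sym_reduction_runtime assms)

end
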